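(* For every integer $d\geqslant 2$, there exist a framework $G_d(\mathbf{p})$ in $\mathbb{R}^d$ (that is, a graph $G_d$ together with a configuration $\mathbf{p}$ of $G_d$ in $\mathbb{R}^d$) and an affine transformation $A:\mathbb{R}^d\to\mathbb{R}^d$ such that $G_d(\mathbf{p})$ is not globally rigid in $\mathbb{R}^d$, while $G_d(A\mathbf{p})$ is globally rigid in $\mathbb{R}^d$.
   Context: Let $d\geqslant 1$ be an integer and let $G=(V,E)$ be a graph with vertex set $V$ and edge set $E$, edges being unordered pairs $\{i,j\}$ of distinct vertices. A bar-and-joint framework (framework, for short) $G(\mathbf{p})$ in $\mathbb{R}^d$ is a graph $G=(V,E)$ together with a configuration $\mathbf{p}$, i.e. an assignment of a point $\mathbf{p}_i\in\mathbb{R}^d$ to each vertex $i\in V$. $|\mathbf{x}-\mathbf{y}|$ denotes the Euclidean distance between $\mathbf{x},\mathbf{y}\in\mathbb{R}^d$. Two frameworks $G(\mathbf{p})$ and $G(\mathbf{q})$ in $\mathbb{R}^d$ (with the same graph $G$) are equivalent to each other if $|\mathbf{p}_i-\mathbf{p}_j|=|\mathbf{q}_i-\mathbf{q}_j|$ for every edge $\{i,j\}\in E$; they are congruent to each other if $|\mathbf{p}_i-\mathbf{p}_j|=|\mathbf{q}_i-\mathbf{q}_j|$ for all $i,j\in V$. A framework $G(\mathbf{p})$ is globally rigid in $\mathbb{R}^d$ if all frameworks $G(\mathbf{q})$ in $\mathbb{R}^d$ which are equivalent to $G(\mathbf{p})$ are congruent to $G(\mathbf{p})$. An affine transformation of $\mathbb{R}^d$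 is a bijective affine map $\mathbb{R}^d\to\mathbb{R}^d$. For an affine transformation $A:\mathbb{R}^d\to\mathbb{R}^d$ and a framework $G(\mathbf{p})$ in $\mathbb{R}^d$, $A\mathbf{p}$ denotes the configuration of $G$ given by $(A\mathbf{p})_k=A(\mathbf{p}_k)$ for $k\in V$. *)

theory Defs
  imports "HOL-Analysis.Analysis"
begin

definition simple_graph :: "'v set \<Rightarrow> 'v set set \<Rightarrow> bool" where
  "simple_graph V E \<longleftrightarrow> finite V \<and> (\<forall>e\<in>E. e \<subseteq> V \<and> card e = 2)"

(* A configuration is a total function on the vertex type. Every notion below
   only inspects its values at vertices in V. *)

definition equivalent_frameworks ::
  "'v set set \<Rightarrow> ('v \<Rightarrow> real ^ 'n) \<Rightarrow> ('v \<Rightarrow> real ^ 'n) \<Rightarrow> bool" where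
  "equivalent_frameworks E p q \<longleftrightarrow>
     (\<forall>i j. {i, j} \<in> E \<longrightarrow> dist (p i) (p j) = dist (q i) (q j))"

definition congruent_frameworks ::
  "'v set \<Rightarrow> ('v \<Rightarrow> real ^ 'n) \<Rightarrow> ('v \<Rightarrow> real ^ 'n) \<Rightarrow> bool" where
  "congruent_frameworks V p q \<longleftrightarrow>
     (\<forall>i\<in>V. \<forall>j\<in>V. dist (p i) (p j) = dist (q i) (q j))"

definition globally_rigid ::
  "'v set \<Rightarrow> 'v set set \<Rightarrow> ('v \<Rightarrow> real ^ 'n) \<Rightarrow> bool" where
  "globally_rigid V E p \<longleftrightarrow>
     (\<forall>q :: 'v \<Rightarrow> real ^ 'n. equivalent_frameworks E p q \<longrightarrow> congruent_frameworks V p q)"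

definition affine_transformation :: "(real ^ 'n \<Rightarrow> real ^ 'n) \<Rightarrow> bool" where
  "affine_transformation A \<longleftrightarrow>
     bij A \<and> (\<exists>L b. linear L \<and> (\<forall>x. A x = L x + b))"

end

(* On the complete graph with vertices at the origin, at the endpoints of an orthonormal basis e_0, e_1, ...,
   and at two further points u, v of the plane of e_0 and e_1 with nonzero coordinates, delete the edges from u to e_0 and from v
   to e_1. The remaining bars determine u up to reflection in the hyperplane orthogonal to e_0, and v
   up to reflection in the hyperplane orthogonal to e_1. The bar from u to v excludes reflecting only
   one of them; it excludes reflecting both unless u and v are orthogonal, and orthogonality is not
   an affine property. *)
theory Submission
  imports Defs
begin

text \<open>Parseval: an orthonormal family of \<open>DIM('a)\<close> vectors is independent, hence
  spans. The basis is arbitrary because it will be made of points of an unknown equivalent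
  framework.\<close>

lemma inner_orthonormal_family:
  fixes f :: "'i \<Rightarrow> 'a::euclidean_space"
  assumes "finite S" "card S = DIM('a)"
    and orth: "\<And>i j. i \<in> S \<Longrightarrow> j \<in> S \<Longrightarrow> f i \<bullet> f j = (if i = j then 1 else 0)"
  shows "x \<bullet> y = (\<Sum>i\<in>S. (x \<bullet> f i) * (y \<bullet> f i))"
proof -
  have inj: "inj_on f S"
    by (rule inj_onI) (metis orth zero_neq_one)
  have pw: "pairwise orthogonal (f ` S)"
    by (auto simp: pairwise_def orthogonal_def orth)
  have "0 \<notin> f ` S"
    using orth by force
  then have "independent (f ` S)"
    using pw pairwise_orthogonal_independent by blast
  moreover have "card (f ` S) = DIM('a)"
    using inj assms(2) by (simp add: card_image)
  ultimately have "span (f ` S) = UNIV"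
    by (metis card_ge_dim_independent dim_UNIV order_refl subset_UNIV top.extremum_unique)
  then have "x = (\<Sum>b\<in>f ` S. (x \<bullet> b) *\<^sub>R b)"
    using assms(1) by (intro orthonormal_basis_expand[OF pw, symmetric]) (auto simp: norm_eq_1 orth)
  also have "\<dots> = (\<Sum>i\<in>S. (x \<bullet> f i) *\<^sub>R f i)"
    using inj by (simp add: sum.reindex)
  finally have "x \<bullet> y = (\<Sum>i\<in>S. (x \<bullet> f i) *\<^sub>R f i) \<bullet> y"
    by simp
  then show ?thesis
    by (simp add: inner_sum_left inner_commute[of y])
qed

text \<open>Polarization: with \<open>z\<close> a vertex joined to all others, bar lengths become
  Gram matrix entries of vectors based at \<open>z\<close>.\<close>

lemma inner_diff_eq_dist:
  fixes x y z :: "'a::real_inner"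
  shows "(x - z) \<bullet> (y - z) = ((dist x z)\<^sup>2 + (dist y z)\<^sup>2 - (dist x y)\<^sup>2) / 2"
  by (simp add: dist_norm power2_norm_eq_inner algebra_simps inner_commute)

lemma dist_eq_iff_inner:
  fixes x y :: "'a::real_inner" and x' y' :: "'b::real_inner"
  shows "dist x y = dist x' y' \<longleftrightarrow> (x - y) \<bullet> (x - y) = (x' - y') \<bullet> (x' - y')"
  by (simp add: dist_norm norm_eq_sqrt_inner)

text \<open>Vertices below \<open>n\<close> are the basis points, \<open>n\<close> is the origin,
  \<open>n + 1\<close> and \<open>n + 2\<close> are u and v.\<close>

definition braced_edges :: "nat \<Rightarrow> nat set set" where
  "braced_edges n = {e. e \<subseteq> {..n + 2} \<and> card e = 2} - {{0, n + 1}, {1, n + 2}}"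

text \<open>The inner product of the last two points is \<open>1 - 4 * s\<^sup>2\<close>: it vanishes for \<open>s = 1/2\<close> but not for \<open>s = 1\<close>.\<close>

definition braced_config :: "nat \<Rightarrow> (nat \<Rightarrow> 'a::real_inner) \<Rightarrow> real \<Rightarrow> nat \<Rightarrow> 'a" where
  "braced_config n b s k =
     (if k < n then (if k = 1 then s else 1) *\<^sub>R b k
      else if k = n then 0
      else if k = n + 1 then b 0 + s *\<^sub>R b 1
      else b 0 - (4 * s) *\<^sub>R b 1)"

lemma simple_graph_braced: "simple_graph {..n + 2} (braced_edges n)"
  by (auto simp: simple_graph_def braced_edges_def)

lemma braced_edge_iff:
  "i < j \<Longrightarrow> {i, j} \<in> braced_edges n \<longleftrightarrow>
     j \<le> n + 2 \<and> \<not> (i = 0 \<and> j = n + 1) \<and> \<not> (i = 1 \<and> j = n + 2)"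
  by (auto simp: braced_edges_def doubleton_eq_iff)

lemma equivalent_frameworks_orderedI:
  assumes "\<And>i. {i} \<notin> E"
    and "\<And>i j :: nat. i < j \<Longrightarrow> {i, j} \<in> E \<Longrightarrow> dist (p i) (p j) = dist (q i) (q j)"
  shows "equivalent_frameworks E p q"
  unfolding equivalent_frameworks_def
proof (intro allI impI)
  fix i j assume "{i, j} \<in> E"
  then show "dist (p i) (p j) = dist (q i) (q j)"
    using assms(1)[of i] assms(2)[of i j] assms(2)[of j i]
    by (cases i j rule: linorder_cases) (auto simp: dist_commute insert_commute)
qed

lemma braced_not_globally_rigid:
  fixes b :: "nat \<Rightarrow> real ^ 'n"
  assumes "n \<ge> 2"
    and orth: "\<And>i j. i < n \<Longrightarrow> j < n \<Longrightarrow> b i \<bullet> b j = (if i = j then 1 else 0)"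
  shows "\<not> globally_rigid {..n + 2} (braced_edges n) (braced_config n b (1/2))"
proof
  let ?p = "braced_config n b (1/2)"
  \<comment> \<open>Both reflections at once: in the plane of \<open>b 0\<close> and
    \<open>b 1\<close>, u = (1, 1/2) becomes (-1, 1/2) and v = (1, -2) becomes (1, 2). The norms are
    kept and the inner product of u and v changes sign; being 0, it is kept too, and so is the bar
    from u to v.\<close>
  let ?q = "?p(n + 1 := - b 0 + (1/2) *\<^sub>R b 1, n + 2 := b 0 + 2 *\<^sub>R b 1)"
  have eq: "equivalent_frameworks (braced_edges n) ?p ?q"
  proof (rule equivalent_frameworks_orderedI)
    show "{i} \<notin> braced_edges n" for i
      by (simp add: braced_edges_def)
  next
    fix i j :: nat assume "i < j" "{i, j} \<in> braced_edges n"
    then have "j \<le> n + 2" "\<not> (i = 0 \<and> j = n + 1)" "\<not> (i = 1 \<and> j = n + 2)"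
      by (simp_all add: braced_edge_iff)
    then consider "j \<le> n" | "j = n + 1" "i = n" | "j = n + 1" "i < n" "i \<noteq> 0"
      | "j = n + 2" "i = n" | "j = n + 2" "i < n" "i \<noteq> 1" | "j = n + 2" "i = n + 1"
      using \<open>i < j\<close> by linarith
    then show "dist (?p i) (?p j) = dist (?q i) (?q j)"
      using \<open>i < j\<close> \<open>n \<ge> 2\<close> unfolding dist_eq_iff_inner inner_diff_left inner_diff_right
      by cases (auto simp: braced_config_def orth inner_diff_left inner_diff_right
          inner_add_left inner_add_right)
  qed
  assume "globally_rigid {..n + 2} (braced_edges n) ?p"
  \<comment> \<open>A deleted pair detects the change: its squared distance is 1/4 in
    \<open>?p\<close> and 17/4 in \<open>?q\<close>.\<close>
  then have "dist (?p 0) (?p (n + 1)) = dist (?q 0) (?q (n + 1))"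
    using eq unfolding globally_rigid_def congruent_frameworks_def by auto
  then show False
    using \<open>n \<ge> 2\<close> unfolding dist_eq_iff_inner inner_diff_left inner_diff_right
    by (simp add: braced_config_def orth inner_diff_left inner_diff_right
          inner_add_left inner_add_right)
qed

lemma braced_globally_rigid:
  fixes b :: "nat \<Rightarrow> real ^ 'n"
  assumes "CARD('n) = n" "n \<ge> 2"
    and orth: "\<And>i j. i < n \<Longrightarrow> j < n \<Longrightarrow> b i \<bullet> b j = (if i = j then 1 else 0)"
  shows "globally_rigid {..n + 2} (braced_edges n) (braced_config n b 1)"
  unfolding globally_rigid_def
proof (intro allI impI)
  let ?p = "braced_config n b 1"
  let ?u = "n + 1" and ?v = "n + 2"
  fix q :: "nat \<Rightarrow> real ^ 'n"
  assume eq: "equivalent_frameworks (braced_edges n) ?p q"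
  define Q where "Q k = q k - q n" for k
  have dist_edge: "dist (q i) (q j) = dist (?p i) (?p j)"
    if "i < j" "j \<le> n + 2" "\<not> (i = 0 \<and> j = ?u)" "\<not> (i = 1 \<and> j = ?v)" for i j
    using eq that unfolding equivalent_frameworks_def by (metis braced_edge_iff)
  have dist_n: "dist (q k) (q n) = dist (?p k) (?p n)" if "k \<le> n + 2" for k
    using dist_edge[of k n] dist_edge[of n k] that \<open>n \<ge> 2\<close>
    by (cases k n rule: linorder_cases) (auto simp: dist_commute)
  have p_n: "?p n = 0"
    by (simp add: braced_config_def)
  \<comment> \<open>Vertex \<open>n\<close> is joined to all others, so polarization applies. The
    case \<open>i = j\<close> records the norms.\<close>
  have edge: "Q i \<bullet> Q j = ?p i \<bullet> ?p j"
    if "i \<le> j" "j \<le> n + 2" "\<not> (i = 0 \<and> j = ?u)" "\<not> (i = 1 \<and> j = ?v)" for i j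
  proof -
    have "dist (q i) (q j) = dist (?p i) (?p j)"
      using dist_edge[of i j] that by (cases "i = j") auto
    then show ?thesis
      using dist_n[of i] dist_n[of j] that inner_diff_eq_dist[of "?p i" "?p n" "?p j"]
      by (simp add: Q_def inner_diff_eq_dist p_n)
  qed
  \<comment> \<open>The basis points are pairwise joined, so their images again form an orthonormal
    basis, in which u and v can be given coordinates.\<close>
  have orth_Q: "Q i \<bullet> Q j = (if i = j then 1 else 0)" if "i < n" "j < n" for i j
    using edge[of i j] edge[of j i] that
    by (cases "i \<le> j") (auto simp: braced_config_def orth inner_commute)
  have parseval: "x \<bullet> y = (x \<bullet> Q 0) * (y \<bullet> Q 0) + (x \<bullet> Q 1) * (y \<bullet> Q 1)
      + (\<Sum>k\<in>{2..<n}. (x \<bullet> Q k) * (y \<bullet> Q k))" for x y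
  proof -
    have "{..<n} = insert 0 (insert 1 {2..<n})"
      using \<open>n \<ge> 2\<close> by auto
    moreover have "x \<bullet> y = (\<Sum>k\<in>{..<n}. (x \<bullet> Q k) * (y \<bullet> Q k))"
      using \<open>CARD('n) = n\<close> by (intro inner_orthonormal_family) (auto simp: orth_Q)
    ultimately show ?thesis
      by simp
  qed
  \<comment> \<open>The bars to the remaining basis points keep u and v in the plane of
    \<open>Q 0\<close> and \<open>Q 1\<close>.\<close>
  have pinned: "Q ?u \<bullet> Q k = 0" "Q ?v \<bullet> Q k = 0" if "k \<in> {2..<n}" for k
    using edge[of k ?u] edge[of k ?v] that
    by (auto simp: braced_config_def orth inner_commute inner_add_right inner_diff_right)
  have rest: "(\<Sum>k\<in>{2..<n}. (x \<bullet> Q k) * (y \<bullet> Q k)) = 0"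
    if "x = Q ?u \<or> x = Q ?v" for x y
    using that pinned by (intro sum.neutral) auto
  \<comment> \<open>Originally u = (1, 1) and v = (1, -4); now u = (x, 1) and v = (1, y), with only
    x and y unknown.\<close>
  have "Q ?u \<bullet> Q 1 = 1" "Q ?v \<bullet> Q 0 = 1" "Q ?u \<bullet> Q ?u = 2" "Q ?v \<bullet> Q ?v = 17" "Q ?u \<bullet> Q ?v = -3"
    using edge[of 1 ?u] edge[of 0 ?v] edge[of ?u ?u] edge[of ?v ?v] edge[of ?u ?v] \<open>n \<ge> 2\<close>
    by (auto simp: braced_config_def orth inner_commute
        inner_add_right inner_diff_right inner_add_left inner_diff_left)
  moreover define x y where "x = Q ?u \<bullet> Q 0" and "y = Q ?v \<bullet> Q 1"
  ultimately have "x * x = 1" "y * y = 16" "x + y = -3"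
    using parseval[of "Q ?u" "Q ?u"] parseval[of "Q ?v" "Q ?v"] parseval[of "Q ?u" "Q ?v"]
      rest by simp_all
  \<comment> \<open>Putting \<open>y = -3 - x\<close> into \<open>y * y = 16\<close> and using
    \<open>x * x = 1\<close> leaves \<open>6 * x = 6\<close>. Flipping both signs would give the sum
    3 instead of -3.\<close>
  then have "x = 1" "y = -4"
    by algebra+
  then have missing: "Q 0 \<bullet> Q ?u = ?p 0 \<bullet> ?p ?u" "Q 1 \<bullet> Q ?v = ?p 1 \<bullet> ?p ?v"
    using \<open>n \<ge> 2\<close> unfolding x_def y_def
    by (simp_all add: braced_config_def orth inner_commute inner_add_right inner_diff_right)
  have gram_le: "Q i \<bullet> Q j = ?p i \<bullet> ?p j" if "i \<le> j" "j \<le> n + 2" for i j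
    using edge missing that by blast
  have gram: "Q i \<bullet> Q j = ?p i \<bullet> ?p j" if "i \<le> n + 2" "j \<le> n + 2" for i j
    using gram_le[of i j] gram_le[of j i] that by (cases "i \<le> j") (auto simp: inner_commute)
  show "congruent_frameworks {..n + 2} ?p q"
    unfolding congruent_frameworks_def
  proof (intro ballI)
    fix i j assume "i \<in> {..n + 2}" "j \<in> {..n + 2}"
    then have "(Q i - Q j) \<bullet> (Q i - Q j) = (?p i - ?p j) \<bullet> (?p i - ?p j)"
      by (simp add: inner_diff_left inner_diff_right gram)
    then show "dist (?p i) (?p j) = dist (q i) (q j)"
      unfolding dist_eq_iff_inner by (simp add: Q_def)
  qed
qed

theorem theorem1:
  assumes "CARD('n::finite) \<ge> 2"
  shows "\<exists>(V :: nat set) E (p :: nat \<Rightarrow> real ^ 'n) A.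
           simple_graph V E \<and> affine_transformation A \<and>
           \<not> globally_rigid V E p \<and> globally_rigid V E (A \<circ> p)"
proof -
  define n where "n = CARD('n)"
  obtain g :: "nat \<Rightarrow> 'n" where g: "bij_betw g {..<n} UNIV"
    using ex_bij_betw_nat_finite[of "UNIV :: 'n set"] by (auto simp: n_def atLeast0LessThan)
  define b :: "nat \<Rightarrow> real ^ 'n" where "b k = axis (g k) 1" for k
  have "n \<ge> 2"
    using assms by (simp add: n_def)
  have g_eq: "g i = g j \<longleftrightarrow> i = j" if "i < n" "j < n" for i j
    using g that by (auto simp: bij_betw_def inj_on_def)
  then have orth: "b i \<bullet> b j = (if i = j then 1 else 0)" if "i < n" "j < n" for i j
    using that by (simp add: b_def inner_axis_axis)
  \<comment> \<open>Scales the coordinate along \<open>b 1\<close>. In \<open>braced_config\<close>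
    the parameter \<open>s\<close> enters only as a factor of that coordinate, so doubling it turns
    \<open>s = 1/2\<close> into \<open>s = 1\<close>.\<close>
  define stretch :: "real \<Rightarrow> real ^ 'n \<Rightarrow> real ^ 'n"
    where "stretch c x = (\<chi> i. if i = g 1 then c * x $ i else x $ i)" for c x
  have "linear (stretch 2)"
    by (rule linearI) (auto simp: stretch_def vec_eq_iff algebra_simps)
  moreover have "bij (stretch 2)"
    by (rule bij_betw_byWitness[where f' = "stretch (1/2)"])
      (auto simp: stretch_def vec_eq_iff)
  ultimately have affine: "affine_transformation (stretch 2)"
    unfolding affine_transformation_def by (metis add.right_neutral)
  have "stretch 2 \<circ> braced_config n b (1/2) = braced_config n b 1"
  proof
    fix k
    show "(stretch 2 \<circ> braced_config n b (1/2)) k = braced_config n b 1 k"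
      using g_eq[of 0 1] g_eq[of k 1] \<open>n \<ge> 2\<close>
      by (auto simp: braced_config_def stretch_def b_def vec_eq_iff axis_def)
  qed
  then show ?thesis
    using simple_graph_braced[of n] affine orth \<open>n \<ge> 2\<close>
      braced_not_globally_rigid[of n b] braced_globally_rigid[of n b]
    by (metis n_def)
qed

end
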